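(* The identities $${}_2F_1\left(\begin{array}{c}2t^2-5t+4,\ 3\\ -2t^2+3t+2\end{array}\middle|-1\right)=-\frac14\,t\,(2t^2-3t-1),$$ $${}_2F_1\left(\begin{array}{c}6t^2-11t+6,\ 4\\ -6t^2+5t+3\end{array}\middle|-1\right)=-\frac1{24}\,t\,(6t+1)\,(6t^2-5t-2)$$ hold, each for all $t\in\mathbb{C}$ for which the ${}_2F_1(-1)$ series on its left-hand side converges.
   Context: ${}_2F_1\left(\begin{array}{c}a,b\\ c\end{array}\middle|-1\right)=\sum_{k\ge0}\frac{(a)_k(b)_k}{(c)_k\,k!}(-1)^k$, where $(a)_k=a(a+1)\cdots(a+k-1)$, $(a)_0=1$, and the lower parameter $c$ is required not to be a non-positive integer. The series converges if $\operatorname{Re}(c-a-b)>-1$. *)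

theory Defs
  imports "HOL-Analysis.Analysis"
begin

definition hyp2F1_term :: "complex \<Rightarrow> complex \<Rightarrow> complex \<Rightarrow> complex \<Rightarrow> nat \<Rightarrow> complex" where
  "hyp2F1_term a b c z k =
     pochhammer a k * pochhammer b k / (pochhammer c k * fact k) * z ^ k"

definition hyp2F1 :: "complex \<Rightarrow> complex \<Rightarrow> complex \<Rightarrow> complex \<Rightarrow> complex" where
  "hyp2F1 a b c z = (\<Sum>k. hyp2F1_term a b c z k)"

text \<open>
  Because of the convention \<open>x / 0 = 0\<close>, a non-positive integer lower parameter would
  give a terminating, hence summable, sequence of terms; it has to be excluded explicitly.
  Convergence is convergence of the partial sums, not absolute convergence.
\<close>

definition hyp2F1_converges :: "complex \<Rightarrow> complex \<Rightarrow> complex \<Rightarrow> complex \<Rightarrow> bool" where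
  "hyp2F1_converges a b c z \<longleftrightarrow> c \<notin> \<int>\<^sub>\<le>\<^sub>0 \<and> summable (hyp2F1_term a b c z)"

end

(* On the two parabolas the series is Gosper-summable: for a polynomial q in k, the term is the
   forward difference of G k = (-1)^k (a)_k / (c)_k * (c + k - 1) * q k.  With b = 3 or 4 one has
   (b)_k / k! = O(k^(b-1)) and deg q = b - 2, so G k is a bounded multiple of the k-th term; hence
   G k tends to 0 as soon as the series converges, and the sum is - G 0. *)
theory Submission
  imports Defs
begin

text \<open>Up to sign, \<open>rec\<close> is Gosper's equation for the certificate
  \<open>q\<close>. Summability enters only through the terms tending to 0, so conditional
  convergence is enough; \<open>ratio\<close> transfers this limit to the telescoping
  sequence.\<close>

lemma hyp2F1_minus_one_telescope:
  fixes a b c :: complex and q :: "nat \<Rightarrow> complex"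
  assumes conv: "hyp2F1_converges a b c (-1)"
    and b: "b \<notin> \<int>\<^sub>\<le>\<^sub>0"
    and rec: "\<And>k. (a + of_nat k) * q (Suc k) + (c + of_nat k - 1) * q k
                   = - (pochhammer b k / fact k)"
    and ratio: "convergent (\<lambda>k. (c + of_nat k - 1) * q k / (pochhammer b k / fact k))"
  shows "hyp2F1 a b c (-1) = (1 - c) * q 0"
proof -
  define f where "f = hyp2F1_term a b c (-1)"
  define G where
    "G k = (-1)^k * pochhammer a k / pochhammer c k * ((c + of_nat k - 1) * q k)" for k
  from conv have c: "c \<notin> \<int>\<^sub>\<le>\<^sub>0" and "summable f"
    by (auto simp: hyp2F1_converges_def f_def)
  then have f0: "f \<longlonglongrightarrow> 0"
    using summable_LIMSEQ_zero by blast
  have pc: "pochhammer c k \<noteq> 0" and pb: "pochhammer b k \<noteq> 0" for k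
    using b c by (auto simp: pochhammer_eq_0_iff)
  have ck: "c + of_nat k \<noteq> 0" for k
    using c by (metis plus_of_nat_eq_0_imp)
  \<comment> \<open>The factor \<open>pochhammer a k\<close> is shared by both sides and may vanish;
    only \<open>pochhammer b k / fact k\<close> is divided out, and the assumption on
    \<open>b\<close> keeps it nonzero.\<close>
  have "G = (\<lambda>k. f k * ((c + of_nat k - 1) * q k / (pochhammer b k / fact k)))"
    by (rule ext) (simp add: G_def f_def hyp2F1_term_def pb pc divide_simps)
  moreover obtain L where "(\<lambda>k. (c + of_nat k - 1) * q k / (pochhammer b k / fact k)) \<longlonglongrightarrow> L"
    using ratio by (auto simp: convergent_def)
  ultimately have "G \<longlonglongrightarrow> 0"
    using tendsto_mult[OF f0] by fastforce
  then have "(\<lambda>k. G (Suc k) - G k) sums (0 - G 0)"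
    by (rule telescope_sums)
  moreover have "G (Suc k) - G k = f k" for k
  proof -
    \<comment> \<open>The factor \<open>c + of_nat k - 1\<close> of \<open>G k\<close> becomes
      \<open>c + of_nat k\<close> at \<open>Suc k\<close> and cancels the last factor of
      \<open>pochhammer c (Suc k)\<close>.\<close>
    have "G (Suc k) = - ((-1)^k * pochhammer a k / pochhammer c k * ((a + of_nat k) * q (Suc k)))"
      using pc[of k] ck[of k] by (simp add: G_def pochhammer_Suc)
    moreover have "- (s * y) - s * x = - (s * (y + x))" for s x y :: complex
      by (simp add: algebra_simps)
    ultimately have "G (Suc k) - G k = - ((-1)^k * pochhammer a k / pochhammer c k
        * ((a + of_nat k) * q (Suc k) + (c + of_nat k - 1) * q k))"
      by (simp only: G_def)
    then show ?thesis
      by (simp add: rec f_def hyp2F1_term_def)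
  qed
  ultimately have "f sums (- G 0)"
    by simp
  then show ?thesis
    by (simp add: hyp2F1_def f_def G_def sums_iff algebra_simps)
qed

text \<open>As \<open>(3)_k = (k+2)! / 2\<close>, the quotient is the binomial coefficient
  \<open>(k+2) choose 2\<close>. Being a polynomial in \<open>k\<close>, it turns \<open>rec\<close>
  into a polynomial identity.\<close>

lemma pochhammer_3_div_fact:
  "pochhammer (3::complex) k / fact k = (of_nat k + 1) * (of_nat k + 2) / 2"
proof -
  have "pochhammer (3::complex) k = (of_nat k + 1) * (of_nat k + 2) / 2 * fact k"
  proof (induction k)
    case (Suc k)
    show ?case
      unfolding pochhammer_Suc Suc fact_Suc of_nat_Suc by (simp add: algebra_simps)
  qed simp
  then show ?thesis
    by simp
qed

lemma pochhammer_4_div_fact: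
  "pochhammer (4::complex) k / fact k
     = (of_nat k + 1) * (of_nat k + 2) * (of_nat k + 3) / 6"
proof -
  have "pochhammer (4::complex) k = (of_nat k + 1) * (of_nat k + 2) * (of_nat k + 3) / 6 * fact k"
  proof (induction k)
    case (Suc k)
    show ?case
      unfolding pochhammer_Suc Suc fact_Suc of_nat_Suc by (simp add: algebra_simps)
  qed simp
  then show ?thesis
    by simp
qed

lemma of_nat_add_of_nat_neq_0:
  "m > 0 \<Longrightarrow> (of_nat k + of_nat m :: complex) \<noteq> 0"
  by (metis add_is_0 less_numeral_extra(3) of_nat_add of_nat_eq_0_iff)

lemma tendsto_const_div_of_nat_add:
  "(\<lambda>k. z / (of_nat k + of_nat m :: complex)) \<longlonglongrightarrow> 0"
  using LIMSEQ_ignore_initial_segment[OF lim_const_over_n[of z], of m] by simp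

lemma tendsto_ratio_of_nat_add:
  assumes "m > 0"
  shows "(\<lambda>k. (of_nat k + z) / (of_nat k + of_nat m :: complex)) \<longlonglongrightarrow> 1"
proof -
  \<comment> \<open>Positivity of \<open>m\<close> matters at \<open>k = 0\<close>: for
    \<open>m = 0\<close> the left side would be 0 and the right side 1.\<close>
  have "(of_nat k + z) / (of_nat k + of_nat m) = 1 + (z - of_nat m) / (of_nat k + of_nat m)" for k
    using of_nat_add_of_nat_neq_0[OF assms, of k] by (simp add: field_simps)
  then show ?thesis
    using tendsto_add[OF tendsto_const tendsto_const_div_of_nat_add, of 1 "z - of_nat m" m] by simp
qed

lemma hyp2F1_3_minus_one:
  fixes t :: complex
  assumes "hyp2F1_converges (2*t^2 - 5*t + 4) 3 (-2*t^2 + 3*t + 2) (-1)"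
  shows "hyp2F1 (2*t^2 - 5*t + 4) 3 (-2*t^2 + 3*t + 2) (-1) = -(1/4) * t * (2*t^2 - 3*t - 1)"
proof -
  define c where "c = -2*t^2 + 3*t + 2"
  \<comment> \<open>The parameter \<open>t\<close> marks the root \<open>-t\<close> of a linear
    certificate. Comparing coefficients of \<open>k\<close> in \<open>rec\<close> forces
    \<open>a + c = 6 - 2*t\<close> and then \<open>a = 4 - t * (5 - 2*t)\<close>, which is the given
    parabola.\<close>
  define q where "q k = - (of_nat k + t) / 4" for k :: nat
  have "hyp2F1 (2*t^2 - 5*t + 4) 3 c (-1) = (1 - c) * q 0"
  proof (rule hyp2F1_minus_one_telescope)
    show "hyp2F1_converges (2*t^2 - 5*t + 4) 3 c (-1)"
      using assms by (simp add: c_def)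
    show "(3::complex) \<notin> \<int>\<^sub>\<le>\<^sub>0"
      by simp
    show "(2*t^2 - 5*t + 4 + of_nat k) * q (Suc k) + (c + of_nat k - 1) * q k
        = - (pochhammer 3 k / fact k)" for k
      unfolding pochhammer_3_div_fact q_def c_def by (simp add: field_simps power2_eq_square)
    \<comment> \<open>Each linear factor of the numerator is paired with one of the denominator, so
      that every quotient tends to 1; the identities that follow regroup this product into the
      quotient required.\<close>
    have "(\<lambda>k. -(1/2) * ((of_nat k + (c - 1)) / (of_nat k + of_nat 1)
            * ((of_nat k + t) / (of_nat k + of_nat 2)))) \<longlonglongrightarrow> -(1/2) * (1 * 1)"
      by (intro tendsto_mult tendsto_const tendsto_ratio_of_nat_add) auto
    moreover have "-(1/2) * (A / u * (B / v)) = A * (- B / 4) / (u * v / 2)"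
      for A B u v :: complex
      by simp
    moreover have "of_nat k + (c - 1) = c + of_nat k - 1" for k
      by simp
    ultimately show "convergent (\<lambda>k. (c + of_nat k - 1) * q k / (pochhammer 3 k / fact k))"
      by (intro convergentI) (simp only: pochhammer_3_div_fact q_def of_nat_1 of_nat_numeral)
  qed
  then show ?thesis
    by (simp add: c_def q_def field_simps power2_eq_square)
qed

lemma hyp2F1_4_minus_one:
  fixes t :: complex
  assumes "hyp2F1_converges (6*t^2 - 11*t + 6) 4 (-6*t^2 + 5*t + 3) (-1)"
  shows "hyp2F1 (6*t^2 - 11*t + 6) 4 (-6*t^2 + 5*t + 3) (-1)
           = -(1/24) * t * (6*t + 1) * (6*t^2 - 5*t - 2)"
proof -
  define c where "c = -6*t^2 + 5*t + 3"
  \<comment> \<open>A quadratic certificate with leading coefficient \<open>-1/12\<close>; the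
    \<open>k^2\<close> coefficient of \<open>rec\<close> corresponds to
    \<open>a + c = 9 - 6*t\<close>. Splitting off the constant term leaves a product of linear
    factors, ready for the limit below.\<close>
  define q where
    "q k = - (2 * of_nat k * (of_nat k + (1 + 3*t)) + t * (6*t + 1)) / 24" for k :: nat
  have "hyp2F1 (6*t^2 - 11*t + 6) 4 c (-1) = (1 - c) * q 0"
  proof (rule hyp2F1_minus_one_telescope)
    show "hyp2F1_converges (6*t^2 - 11*t + 6) 4 c (-1)"
      using assms by (simp add: c_def)
    show "(4::complex) \<notin> \<int>\<^sub>\<le>\<^sub>0"
      by simp
    show "(6*t^2 - 11*t + 6 + of_nat k) * q (Suc k) + (c + of_nat k - 1) * q k
        = - (pochhammer 4 k / fact k)" for k
      unfolding pochhammer_4_div_fact q_def c_def by (simp add: field_simps power2_eq_square)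
    \<comment> \<open>The summand \<open>0\<close> in \<open>of_nat k + 0\<close> gives this factor
      the shape of \<open>tendsto_ratio_of_nat_add\<close>; the constant term of the certificate
      contributes a product of two null sequences.\<close>
    have "(\<lambda>k. -(1/4) * ((of_nat k + (c - 1)) / (of_nat k + of_nat 1)
            * (2 * ((of_nat k + 0) / (of_nat k + of_nat 2)
                  * ((of_nat k + (1 + 3*t)) / (of_nat k + of_nat 3)))
               + t * (6*t + 1) / (of_nat k + of_nat 2) * (1 / (of_nat k + of_nat 3)))))
          \<longlonglongrightarrow> -(1/4) * (1 * (2 * (1 * 1) + 0 * 0))"
      by (intro tendsto_mult tendsto_add tendsto_const
          tendsto_ratio_of_nat_add tendsto_const_div_of_nat_add) auto
    moreover have "2 * (B / v * (C / w)) + D / v * (1 / w) = (2 * B * C + D) / (v * w)"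
      for B C D v w :: complex
      by (simp add: add_divide_distrib mult.assoc)
    moreover have "-(1/4) * (A / u * (E / (v * w))) = A * (- E / 24) / (u * v * w / 6)"
      for A E u v w :: complex
      by simp
    moreover have "of_nat k + (c - 1) = c + of_nat k - 1" for k
      by simp
    ultimately show "convergent (\<lambda>k. (c + of_nat k - 1) * q k / (pochhammer 4 k / fact k))"
      by (intro convergentI)
         (simp only: pochhammer_4_div_fact q_def add_0_right of_nat_1 of_nat_numeral)
  qed
  \<comment> \<open>Here \<open>1 - c = 6*t^2 - 5*t - 2\<close> and
    \<open>q 0 = - t * (6*t + 1) / 24\<close> supply the factors of the closed form.\<close>
  then show ?thesis
    by (simp add: c_def q_def field_simps power2_eq_square)
qed

theorem mainTheorem8:
  shows "(\<forall>t::complex.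
            hyp2F1_converges (2*t^2 - 5*t + 4) 3 (-2*t^2 + 3*t + 2) (-1) \<longrightarrow>
            hyp2F1 (2*t^2 - 5*t + 4) 3 (-2*t^2 + 3*t + 2) (-1)
              = -(1/4) * t * (2*t^2 - 3*t - 1))
       \<and> (\<forall>t::complex.
            hyp2F1_converges (6*t^2 - 11*t + 6) 4 (-6*t^2 + 5*t + 3) (-1) \<longrightarrow>
            hyp2F1 (6*t^2 - 11*t + 6) 4 (-6*t^2 + 5*t + 3) (-1)
              = -(1/24) * t * (6*t + 1) * (6*t^2 - 5*t - 2))"
  using hyp2F1_3_minus_one hyp2F1_4_minus_one by blast

end
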